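(* Let $n$ be a positive integer with prime factorization \[ n=2^{a}3^{b}\prod_{i=1}^{r}p_i^{v_i}\prod_{j=1}^{s}q_j^{w_j}, \] where each $p_i\equiv 1\pmod 4$ and each $q_j$ satisfies $3<q_j\equiv 3\pmod 4$. Define $\Lambda(n)=\prod_{i=1}^{r}(1+v_i)\prod_{j=1}^{s}\frac{1+(-1)^{w_j}}{2}$, and let $t$ be the number of prime factors of $n$, counted with multiplicity, that are congruent to $5\pmod{12}$. Then \[ (1,0,9;n)=\begin{cases}(1+(-1)^{a+t})\Lambda(n), & b=0,\\ 0, & b \text{ odd},\\ 4\Lambda(n), & b>0,\ b \text{ even},\end{cases} \qquad (2,2,5;n)=\begin{cases}(1-(-1)^{a+t})\Lambda(n), & b=0,\\ 0, & b \text{ odd},\\ 4\Lambda(n), & b>0,\ b \text{ even}.\end{cases} \]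
   Context: For a binary quadratic form $(a,b,c)$, i.e. $ax^2+bxy+cy^2$, the quantity $(a,b,c;n)$ denotes the number of pairs $(x,y)\in\mathbb{Z}^2$ with $ax^2+bxy+cy^2=n$. *)

theory Defs
  imports Complex_Main "HOL-Computational_Algebra.Primes" "HOL-Number_Theory.Cong"
begin

text \<open>The set counted is finite whenever the form is positive definite
  (\<open>a > 0\<close> and \<open>b\<^sup>2 < 4 * a * c\<close>), so \<open>card\<close> is then the genuine number of representations.\<close>
definition form_reps :: "int \<Rightarrow> int \<Rightarrow> int \<Rightarrow> int \<Rightarrow> nat" where
  "form_reps a b c n = card {(x :: int, y :: int). a * x\<^sup>2 + b * x * y + c * y\<^sup>2 = n}"

definition Lam :: "nat \<Rightarrow> rat" where
  "Lam n =
     (\<Prod>p | p \<in> prime_factors n \<and> [p = 1] (mod 4). 1 + of_nat (multiplicity p n)) *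
     (\<Prod>q | q \<in> prime_factors n \<and> 3 < q \<and> [q = 3] (mod 4). (1 + (-1) ^ multiplicity q n) / 2)"

definition num_5_mod_12 :: "nat \<Rightarrow> nat" where
  "num_5_mod_12 n = size (filter_mset (\<lambda>p. [p = 5] (mod 12)) (prime_factorization n))"

end

theory Submission
  imports Defs "HOL-Number_Theory.Euler_Criterion" "HOL-Library.Discrete_Functions"
begin

text \<open>
  Since \<open>2x\<^sup>2 + 2xy + 5y\<^sup>2 = (x - y)\<^sup>2 + (x + 2y)\<^sup>2\<close>, both forms count representations \<open>n = u\<^sup>2 + v\<^sup>2\<close> with a
  condition modulo 3: \<open>3 | v\<close> for \<open>(1,0,9)\<close> and \<open>3 | v - u\<close> for \<open>(2,2,5)\<close>. If \<open>3 | n\<close> then \<open>3\<close> divides \<open>u\<close>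
  and \<open>v\<close>, and both conditions are void. If \<open>n \<equiv> 1\<close>, exactly one of \<open>u\<close>, \<open>v\<close> is divisible by 3, and if
  \<open>n \<equiv> 2\<close>, exactly one of \<open>v - u\<close>, \<open>v + u\<close> is; by symmetry one of the two forms gets half of the
  representations and the other none. When \<open>n\<close> is a sum of two squares prime to 3, its residue is
  \<open>(-1)\<^sup>a\<^sup>+\<^sup>t\<close>, because the primes \<open>11 (mod 12)\<close> occur to even powers.

  The number of representations by two squares is computed one prime at a time. For \<open>p \<equiv> 1 (mod 4)\<close> it
  satisfies \<open>r(p\<^sup>2m) = 2r(pm) - r(m)\<close>, with \<open>r(pm) = 2r(m)\<close> if \<open>p\<close> does not divide \<open>m\<close>.
\<close>

section \<open>Representations by two squares: finiteness, doubling and scaling\<close>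

definition two_squares :: "int \<Rightarrow> (int \<times> int) set" where
  "two_squares n = {(x, y). x\<^sup>2 + y\<^sup>2 = n}"

lemma mem_two_squares [simp]: "(x, y) \<in> two_squares n \<longleftrightarrow> x\<^sup>2 + y\<^sup>2 = n"
  by (simp add: two_squares_def)

lemma finite_two_squares [simp]: "finite (two_squares n)"
proof (rule finite_subset)
  have "\<bar>x\<bar> \<le> n" if "x\<^sup>2 + y\<^sup>2 = n" for x y :: int
  proof -
    have "\<bar>x\<bar> \<le> \<bar>x\<bar>\<^sup>2"
      using self_le_power[of "\<bar>x\<bar>" 2] by (cases "x = 0") simp_all
    also have "\<dots> \<le> x\<^sup>2 + y\<^sup>2" by simp
    finally show ?thesis using that by simp
  qed
  note bound = this
  show "two_squares n \<subseteq> {-n..n} \<times> {-n..n}"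
  proof clarify
    fix x y assume "(x, y) \<in> two_squares n"
    then have "x\<^sup>2 + y\<^sup>2 = n" "y\<^sup>2 + x\<^sup>2 = n" by (simp_all add: add.commute)
    from this[THEN bound] show "x \<in> {-n..n} \<and> y \<in> {-n..n}" by auto
  qed
qed simp

lemma two_squares_one: "two_squares 1 = {(1, 0), (-1, 0), (0, 1), (0, -1)}"
proof -
  have "(x, y) \<in> {(1, 0), (-1, 0), (0, 1), (0, -1)}" if "x\<^sup>2 + y\<^sup>2 = 1" for x y :: int
  proof -
    have "x\<^sup>2 \<le> 1\<^sup>2" "y\<^sup>2 \<le> 1\<^sup>2"
      using that zero_le_power2[of x] zero_le_power2[of y] unfolding one_power2 by linarith+
    then have "\<bar>x\<bar> \<le> 1" "\<bar>y\<bar> \<le> 1" unfolding abs_le_square_iff[symmetric] by simp_all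
    then have "x \<in> {-1, 0, 1}" "y \<in> {-1, 0, 1}" by auto
    then show ?thesis using that by auto
  qed
  then show ?thesis by (intro equalityI subrelI) (simp, auto)
qed

text \<open>The map is conjugation followed by multiplication by \<open>1 + i\<close>. It is onto
  because \<open>u\<close> and \<open>v\<close> have equal parity when \<open>u^2 + v^2\<close> is
  even.\<close>

lemma card_two_squares_double: "card (two_squares (2 * n)) = card (two_squares n)"
proof -
  have "bij_betw (\<lambda>(x, y). (x + y, x - y)) (two_squares n) (two_squares (2 * n))"
  proof (rule bij_betw_byWitness[where f' = "\<lambda>(u, v). ((u + v) div 2, (u - v) div 2)"])
    show "(\<lambda>(x, y). (x + y, x - y)) ` two_squares n \<subseteq> two_squares (2 * n)"
      by (auto simp: power2_eq_square algebra_simps)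
    have par: "\<exists>x y. u = x + y \<and> v = x - y" if "u\<^sup>2 + v\<^sup>2 = 2 * n" for u v :: int
    proof -
      have "even (u\<^sup>2 + v\<^sup>2)" using that by simp
      then have "even (u + v)" by simp
      then obtain x where "u + v = 2 * x" by blast
      then have "u = x + (u - x) \<and> v = x - (u - x)" by simp
      then show ?thesis by blast
    qed
    show "\<forall>w\<in>two_squares (2 * n). (case case w of (u, v) \<Rightarrow> ((u + v) div 2, (u - v) div 2) of
        (x, y) \<Rightarrow> (x + y, x - y)) = w"
      by (auto dest!: par)
    show "(\<lambda>(u, v). ((u + v) div 2, (u - v) div 2)) ` two_squares (2 * n) \<subseteq> two_squares n"
    proof clarsimp
      fix u v :: int assume uv: "u\<^sup>2 + v\<^sup>2 = 2 * n"
      from par[OF uv] obtain x y where xy: "u = x + y" "v = x - y" by blast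
      have "(x + y)\<^sup>2 + (x - y)\<^sup>2 = 2 * (x\<^sup>2 + y\<^sup>2)"
        by (simp add: power2_eq_square algebra_simps)
      with uv show "((u + v) div 2)\<^sup>2 + ((u - v) div 2)\<^sup>2 = n"
        unfolding xy by simp
    qed
  qed auto
  from bij_betw_same_card[OF this] show ?thesis by simp
qed

lemma card_two_squares_scale:
  assumes "k \<noteq> 0"
  shows "card {(x, y) \<in> two_squares (k\<^sup>2 * n). k dvd x \<and> k dvd y} = card (two_squares n)"
proof -
  have "{(x, y) \<in> two_squares (k\<^sup>2 * n). k dvd x \<and> k dvd y} = (\<lambda>(x, y). (k * x, k * y)) ` two_squares n"
    using assms by (auto simp: power_mult_distrib distrib_left[symmetric] elim!: dvdE)
  moreover have "inj_on (\<lambda>(x, y). (k * x, k * y)) (two_squares n)"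
    using assms by (auto simp: inj_on_def)
  ultimately show ?thesis by (simp add: card_image)
qed

section \<open>Primes modulo 4 as divisors and values of a sum of two squares\<close>

text \<open>Otherwise \<open>q\<close> divides neither \<open>x\<close> nor \<open>y\<close>;
  raising \<open>x^2 = -y^2\<close> modulo \<open>q\<close> to the odd power
  \<open>(q - 1) / 2\<close> gives \<open>1 = -1\<close> by Fermat.\<close>

lemma prime_3_mod_4_dvd_sum_squares:
  fixes q :: nat and x y :: int
  assumes q: "prime q" "[q = 3] (mod 4)" and dvd: "int q dvd x\<^sup>2 + y\<^sup>2"
  shows "int q dvd x"
proof (rule ccontr)
  assume x: "\<not> int q dvd x"
  have pq: "prime (int q)" using q by simp
  have y: "\<not> int q dvd y"
  proof
    assume "int q dvd y"
    then have "int q dvd y\<^sup>2" by (simp add: power2_eq_square)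
    with dvd have "int q dvd x\<^sup>2" using dvd_add_left_iff by blast
    then show False using x pq prime_dvd_power by blast
  qed
  define e where "e = 2 * (q div 4) + 1"
  have "q = q div 4 * 4 + 3" using q(2) div_mult_mod_eq[of q 4] by (simp add: cong_def)
  then have e: "q - 1 = 2 * e" "odd e" by (simp_all add: e_def)
  have fermat: "[z ^ (q - 1) = 1] (mod int q)" if "\<not> int q dvd z" for z
  proof -
    \<comment> \<open>Fermat's theorem is applied to the natural number |z|; the even exponent then
      removes the absolute value.\<close>
    have "[nat \<bar>z\<bar> ^ (q - 1) = 1] (mod q)"
      using that q by (intro fermat_theorem) (auto simp: int_dvd_int_iff[symmetric])
    then have "[\<bar>z\<bar> ^ (q - 1) = 1] (mod int q)"
      by (simp flip: cong_int_iff)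
    moreover have "even (q - 1)" using e(1) by simp
    ultimately show ?thesis by (simp add: power_even_abs)
  qed
  have "[x\<^sup>2 = - (y\<^sup>2)] (mod int q)"
    using dvd by (simp add: cong_iff_dvd_diff)
  then have "[(x\<^sup>2) ^ e = (- (y\<^sup>2)) ^ e] (mod int q)" by (rule cong_pow)
  then have "[x ^ (q - 1) = - (y ^ (q - 1))] (mod int q)"
    using e by (simp add: power_mult power_minus_odd)
  then have "[1 = - (1 :: int)] (mod int q)"
    using fermat[OF x] fermat[OF y] by (meson cong_minus_minus_iff cong_sym cong_trans)
  then have "int q dvd 2" by (simp add: cong_iff_dvd_diff)
  then have "q \<le> 2" by (auto dest: zdvd_imp_le)
  with q show False unfolding cong_def by (cases "q = 2") (auto dest: prime_ge_2_nat)
qed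

text \<open>Euler's criterion for \<open>-1\<close>, where the exponent \<open>(p - 1) / 2\<close>
  is even.\<close>

lemma prime_1_mod_4_root:
  fixes p :: nat
  assumes p: "prime p" "[p = 1] (mod 4)"
  obtains s :: int where "int p dvd s\<^sup>2 + 1"
proof -
  have "p > 2"
    using p prime_ge_2_nat[of p] unfolding cong_def by (cases "p = 2") auto
  with p have "[Legendre (-1) (int p) = (-1) ^ ((p - 1) div 2)] (mod int p)"
    using euler_criterion by blast
  moreover have "even ((p - 1) div 2)"
  proof -
    have "p = p div 4 * 4 + 1" using p(2) div_mult_mod_eq[of p 4] by (simp add: cong_def)
    then have "p - 1 = 2 * (2 * (p div 4))" by simp
    then show ?thesis by simp
  qed
  ultimately have L: "[Legendre (-1) (int p) = 1] (mod int p)" by simp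
  have "QuadRes (int p) (-1)"
  proof (rule ccontr)
    assume n: "\<not> QuadRes (int p) (-1)"
    have "\<not> [-1 = (0 :: int)] (mod int p)"
      using \<open>p > 2\<close> by (simp add: cong_iff_dvd_diff)
    with n L have "[-1 = (1 :: int)] (mod int p)" by (simp add: Legendre_def)
    then have "int p dvd 2" by (simp add: cong_iff_dvd_diff)
    then show False using \<open>p > 2\<close> by (auto dest: zdvd_imp_le)
  qed
  then show ?thesis using that by (auto simp: QuadRes_def cong_iff_dvd_diff)
qed

text \<open>Thue's pigeonhole argument: the \<open>(k + 1)^2 > p\<close> pairs in \<open>S\<close>
  have a collision of \<open>u - s * v\<close> modulo \<open>p\<close>. The difference
  \<open>(c, d)\<close> of two colliding pairs satisfies \<open>c = s * d\<close> modulo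
  \<open>p\<close>, so \<open>c^2 + d^2\<close> is a multiple of \<open>p\<close> strictly between
  \<open>0\<close> and \<open>2 * p\<close>.\<close>

lemma prime_1_mod_4_two_squares:
  fixes p :: nat
  assumes p: "prime p" "[p = 1] (mod 4)"
  obtains c d :: int where "c\<^sup>2 + d\<^sup>2 = int p"
proof -
  obtain s :: int where s: "int p dvd s\<^sup>2 + 1" using prime_1_mod_4_root[OF p] .
  have p0: "p > 0" using p prime_gt_0_nat by blast
  define k where "k = floor_sqrt p"
  have k: "k\<^sup>2 \<le> p" "p < (k + 1)\<^sup>2"
    using floor_sqrt_power2_le[of p] Suc_floor_sqrt_power2_gt[of p] by (simp_all add: k_def)
  \<comment> \<open>A prime is not a square; this makes the bound \<open>c^2 + d^2 < 2 * p\<close>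
    strict.\<close>
  have "k\<^sup>2 \<noteq> p"
    using p(1) prime_power_iff[of k 2] by auto
  with k have kp: "int k ^ 2 < int p" by (metis le_neq_implies_less of_nat_less_iff of_nat_power)
  define S where "S = {0..int k} \<times> {0..int k}"
  define f where "f = (\<lambda>(u, v). (u - s * v) mod int p)"
  have "f ` S \<subseteq> {0..<int p}" using p0 by (auto simp: f_def)
  then have "card (f ` S) \<le> p" using card_mono[of "{0..<int p}" "f ` S"] by simp
  also have "\<dots> < card S" using k(2) by (simp add: S_def power2_eq_square nat_add_distrib)
  finally have "\<not> inj_on f S" by (rule pigeonhole)
  then obtain u v u' v' where uv: "(u, v) \<in> S" "(u', v') \<in> S" "(u, v) \<noteq> (u', v')" "f (u, v) = f (u', v')"
    by (auto simp: inj_on_def)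
  define c where "c = u - u'"
  define d where "d = v - v'"
  have "int p dvd (u - s * v) - (u' - s * v')"
    using uv(4) by (simp add: f_def mod_eq_dvd_iff)
  then have cd: "int p dvd c - s * d" by (simp add: c_def d_def algebra_simps)
  have "c\<^sup>2 + d\<^sup>2 = (c - s * d) * (c + s * d) + (s\<^sup>2 + 1) * d\<^sup>2"
    by (simp add: power2_eq_square algebra_simps)
  also have "int p dvd \<dots>" using cd s by (metis dvd_add dvd_mult2)
  finally have dvd: "int p dvd c\<^sup>2 + d\<^sup>2" .
  have "\<bar>c\<bar> \<le> int k" "\<bar>d\<bar> \<le> int k" using uv(1,2) by (auto simp: S_def c_def d_def)
  then have "c\<^sup>2 \<le> int k ^ 2" "d\<^sup>2 \<le> int k ^ 2" by (simp_all add: abs_le_square_iff[symmetric])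
  with kp have lt: "c\<^sup>2 + d\<^sup>2 < 2 * int p" by linarith
  have "c \<noteq> 0 \<or> d \<noteq> 0" using uv(3) by (auto simp: c_def d_def)
  then have gt: "c\<^sup>2 + d\<^sup>2 > 0" using sum_power2_gt_zero_iff by blast
  from dvd obtain m where m: "c\<^sup>2 + d\<^sup>2 = int p * m" by blast
  with gt p0 have "m > 0" by (simp add: zero_less_mult_iff)
  moreover from lt m p0 have "m < 2" by (simp add: mult.commute)
  ultimately have "c\<^sup>2 + d\<^sup>2 = int p" using m by simp
  then show ?thesis using that by blast
qed

text \<open>Write \<open>p\<close> as the norm of \<open>\<pi> = c + di\<close>. Multiplication by \<open>\<pi>\<close> and by its conjugate are two
  injections from the Gaussian integers of norm \<open>n\<close> to those of norm \<open>pn\<close>; their images \<open>A 1\<close> and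
  \<open>A (-1)\<close> cover everything and meet exactly in the multiples of \<open>p\<close>.\<close>
lemma card_two_squares_prime_1_mod_4:
  fixes p :: nat
  assumes p: "prime p" "[p = 1] (mod 4)"
  shows "card (two_squares (int p * n)) + card {(x, y) \<in> two_squares (int p * n). int p dvd x \<and> int p dvd y}
    = 2 * card (two_squares n)"
proof -
  obtain c d where cd: "c\<^sup>2 + d\<^sup>2 = int p" using prime_1_mod_4_two_squares[OF p] .
  have pp: "prime (int p)" using p by simp
  have p0: "int p > 0" using p prime_gt_0_nat by simp
  have p_odd: "\<not> int p dvd 2"
  proof
    assume "int p dvd 2"
    then have "p \<le> 2" by (auto dest: zdvd_imp_le)
    with p show False using prime_ge_2_nat[of p] unfolding cong_def by (cases "p = 2") auto
  qed
  \<comment> \<open>If \<open>p\<close> divided \<open>c\<close>, then \<open>c^2 \<le> p\<close>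
    would force \<open>c = 0\<close>, making the prime \<open>p\<close> equal to
    \<open>d^2\<close>.\<close>
  have pc: "\<not> int p dvd c" 
  proof
    assume "int p dvd c"
    then obtain k where k: "c = int p * k" by blast
    have "c\<^sup>2 \<le> int p" using cd zero_le_power2[of d] by linarith
    then have "int p * (int p * k\<^sup>2) \<le> int p * 1" by (simp add: k power2_eq_square ac_simps)
    then have "int p * k\<^sup>2 \<le> 1" using p0 mult_le_cancel_left_pos by blast
    moreover have "int p > 1" using p prime_gt_1_nat by simp
    ultimately have "k\<^sup>2 \<le> 0" by (smt (verit) mult_le_cancel_left1 zero_le_power2)
    then have "c = 0" using k by simp
    then have "d\<^sup>2 = int p" using cd by simp
    then have "prime (d\<^sup>2)" using pp by simp
    then show False using prime_power_iff[of d 2] by simp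
  qed
  \<comment> \<open>Multiplication of \<open>x + iy\<close> by \<open>c + e * d * i\<close>; the
    sign \<open>e\<close> selects the factor or its conjugate.\<close>
  define f where "f = (\<lambda>e (x, y). (c * x - e * d * y, e * d * x + c * y))"
  define A where "A = (\<lambda>e. f e ` two_squares n)"
  \<comment> \<open>The divisibility condition concerns the real part of \<open>x + iy\<close> times
    the conjugate of \<open>c + e * d * i\<close>.\<close>
  have A: "A e = {(x, y) \<in> two_squares (int p * n). int p dvd c * x + e * d * y}"
    (is "_ = ?B") if e: "e\<^sup>2 = 1" for e
  proof
    have ed: "c\<^sup>2 + (e * d)\<^sup>2 = int p" using cd e by (simp add: power_mult_distrib)
    show "A e \<subseteq> ?B"
    proof
      fix w assume "w \<in> A e"
      then obtain x y where n: "x\<^sup>2 + y\<^sup>2 = n" and w: "w = (c * x - e * d * y, e * d * x + c * y)"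
        by (auto simp: A_def f_def two_squares_def)
      have "(c * x - e * d * y)\<^sup>2 + (e * d * x + c * y)\<^sup>2 = (c\<^sup>2 + (e * d)\<^sup>2) * (x\<^sup>2 + y\<^sup>2)"
        by (simp add: power2_eq_square algebra_simps)
      moreover have "c * (c * x - e * d * y) + e * d * (e * d * x + c * y) = (c\<^sup>2 + (e * d)\<^sup>2) * x"
        by (simp add: power2_eq_square algebra_simps)
      ultimately show "w \<in> ?B" using n ed w by simp
    qed
    show "?B \<subseteq> A e"
    proof clarsimp
      fix x y assume n: "x\<^sup>2 + y\<^sup>2 = int p * n" and dvd: "int p dvd c * x + e * d * y"
      \<comment> \<open>This product has norm \<open>p^2 * n\<close>, so its imaginary part is
        divisible by \<open>p\<close> as well; dividing by \<open>p\<close> yields the preimage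
        \<open>(u, v)\<close>.\<close>
      have norm: "(c * x + e * d * y)\<^sup>2 + (c * y - e * d * x)\<^sup>2 = int p * int p * n"
      proof -
        have "(c * x + e * d * y)\<^sup>2 + (c * y - e * d * x)\<^sup>2 = (c\<^sup>2 + (e * d)\<^sup>2) * (x\<^sup>2 + y\<^sup>2)"
          by (simp add: power2_eq_square algebra_simps)
        then show ?thesis using n ed by simp
      qed
      have "int p dvd (c * x + e * d * y)\<^sup>2" using dvd by (simp add: power2_eq_square)
      moreover have "int p dvd (c * x + e * d * y)\<^sup>2 + (c * y - e * d * x)\<^sup>2" unfolding norm by simp
      ultimately have "int p dvd (c * y - e * d * x)\<^sup>2" using dvd_add_right_iff by blast
      then have "int p dvd c * y - e * d * x" using pp prime_dvd_power by blast
      then obtain v where v: "c * y - e * d * x = int p * v" by blast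
      obtain u where u: "c * x + e * d * y = int p * u" using dvd by blast
      have "int p * int p * (u\<^sup>2 + v\<^sup>2) = int p * int p * n"
        using norm unfolding u v by (simp add: power2_eq_square algebra_simps)
      then have uv: "u\<^sup>2 + v\<^sup>2 = n" using p0 by simp
      have "int p * x = c * (c * x + e * d * y) - e * d * (c * y - e * d * x)"
        unfolding ed[symmetric] by (simp add: power2_eq_square algebra_simps)
      then have "int p * x = int p * (c * u - e * d * v)"
        unfolding u v by (simp add: algebra_simps)
      then have x: "x = c * u - e * d * v" using p0 by simp
      have "int p * y = e * d * (c * x + e * d * y) + c * (c * y - e * d * x)"
        unfolding ed[symmetric] by (simp add: power2_eq_square algebra_simps)
      then have "int p * y = int p * (e * d * u + c * v)"
        unfolding u v by (simp add: algebra_simps)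
      then have "y = e * d * u + c * v" using p0 by simp
      with x uv show "(x, y) \<in> A e" unfolding A_def f_def
        by (intro image_eqI[of _ _ "(u, v)"]) simp_all
    qed
  qed
  have cardA: "card (A e) = card (two_squares n)" if e: "e\<^sup>2 = 1" for e
  proof -
    have ed: "c\<^sup>2 + (e * d)\<^sup>2 = int p" using cd e by (simp add: power_mult_distrib)
    have "inj (f e)"
    proof (rule inj_on_inverseI)
      fix w :: "int \<times> int"
      obtain x y where w: "w = (x, y)" by fastforce
      \<comment> \<open>Left inverse: multiply by the conjugate and divide by the norm
        \<open>p\<close>.\<close>
      have "c * (c * x - e * d * y) + e * d * (e * d * x + c * y) = int p * x"
        "c * (e * d * x + c * y) - e * d * (c * x - e * d * y) = int p * y"
        unfolding ed[symmetric] by (simp_all add: power2_eq_square algebra_simps)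
      then show "(\<lambda>(u, v). ((c * u + e * d * v) div int p, (c * v - e * d * u) div int p)) (f e w) = w"
        using p0 by (simp add: f_def w)
    qed
    then show ?thesis unfolding A_def by (intro card_image) (auto intro: inj_on_subset)
  qed
  have "A 1 \<union> A (-1) = two_squares (int p * n)"
  proof -
    have "int p dvd c * x + d * y \<or> int p dvd c * x - d * y" if n: "x\<^sup>2 + y\<^sup>2 = int p * n" for x y
    proof -
      \<comment> \<open>The product of the two linear forms is a multiple of \<open>p\<close>, so
        primality puts each point in one of the two images.\<close>
      have "(c * x + d * y) * (c * x - d * y) = c\<^sup>2 * (x\<^sup>2 + y\<^sup>2) - (c\<^sup>2 + d\<^sup>2) * y\<^sup>2"
        by (simp add: power2_eq_square algebra_simps)
      then have "int p dvd (c * x + d * y) * (c * x - d * y)" unfolding n cd by simp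
      then show ?thesis using pp prime_dvd_mult_iff by blast
    qed
    then show ?thesis by (fastforce simp: A)
  qed
  moreover have "A 1 \<inter> A (-1) = {(x, y) \<in> two_squares (int p * n). int p dvd x \<and> int p dvd y}"
  proof -
    have "int p dvd x \<and> int p dvd y"
      if n: "x\<^sup>2 + y\<^sup>2 = int p * n" and "int p dvd c * x + d * y" "int p dvd c * x - d * y" for x y
    proof -
      have "int p dvd 2 * (c * x)" using dvd_add[OF that(2,3)] by simp
      then have x: "int p dvd x" using pp p_odd pc prime_dvd_mult_iff by metis
      then have "int p dvd x\<^sup>2" by (simp add: power2_eq_square)
      moreover have "int p dvd x\<^sup>2 + y\<^sup>2" unfolding n by simp
      ultimately have "int p dvd y\<^sup>2" using dvd_add_right_iff by blast
      then show ?thesis using x pp prime_dvd_power by blast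
    qed
    then have iff: "int p dvd c * x + d * y \<and> int p dvd c * x - d * y \<longleftrightarrow> int p dvd x \<and> int p dvd y"
      if "x\<^sup>2 + y\<^sup>2 = int p * n" for x y
      using that by (meson dvd_add dvd_diff dvd_mult)
    show ?thesis
    proof (rule Set.set_eqI)
      fix w :: "int \<times> int"
      obtain x y where w: "w = (x, y)" by fastforce
      show "w \<in> A 1 \<inter> A (-1) \<longleftrightarrow> w \<in> {(x, y) \<in> two_squares (int p * n). int p dvd x \<and> int p dvd y}"
        using iff[of x y] by (cases "x\<^sup>2 + y\<^sup>2 = int p * n") (simp_all add: w A)
    qed
  qed
  moreover have "finite (A e)" for e by (simp add: A_def)
  ultimately show ?thesis using card_Un_Int[of "A 1" "A (-1)"] cardA[of 1] cardA[of "-1"] by simp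
qed

section \<open>The contribution of one prime power\<close>

lemma two_squares_no_common_factor:
  fixes k :: int
  assumes "k \<noteq> 0" "\<not> k dvd m"
  shows "{(x, y) \<in> two_squares (k * m). k dvd x \<and> k dvd y} = {}"
proof -
  have False if "x\<^sup>2 + y\<^sup>2 = k * m" "k dvd x" "k dvd y" for x y
  proof -
    have "k * k dvd x\<^sup>2 + y\<^sup>2"
      unfolding power2_eq_square using that by (intro dvd_add mult_dvd_mono)
    then show False using that assms by simp
  qed
  then show ?thesis by auto
qed

text \<open>The local factor at \<open>p\<close> in the two-squares count; among primes, the last
  case is \<open>p = 2\<close>.\<close>

definition two_squares_factor :: "nat \<Rightarrow> nat \<Rightarrow> rat" where
  "two_squares_factor p v =
     (if [p = 1] (mod 4) then 1 + of_nat v else if [p = 3] (mod 4) then (1 + (-1) ^ v) / 2 else 1)"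

text \<open>With \<open>r(v)\<close> the count for \<open>p ^ v * m\<close>: doubling makes
  \<open>r\<close> constant for \<open>p = 2\<close>; for \<open>p = 1\<close> modulo 4,
  \<open>r(v + 2) + r(v) = 2 * r(v + 1)\<close> makes it linear in \<open>v\<close>; for
  \<open>p = 3\<close> modulo 4 every representation of a multiple of \<open>p\<close> is divisible
  by \<open>p\<close>, so \<open>r(v + 2) = r(v)\<close> and \<open>r(1) = 0\<close>.\<close>

lemma card_two_squares_prime_power:
  fixes p m v :: nat
  assumes p: "prime p" and m: "\<not> p dvd m"
  shows "of_nat (card (two_squares (int (p ^ v * m)))) =
    two_squares_factor p v * of_nat (card (two_squares (int m)))"
proof -
  have p0: "int p \<noteq> 0" using p by auto
  have m': "\<not> int p dvd int m" using m by simp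
  let ?D = "\<lambda>k. {(x, y) \<in> two_squares k. int p dvd x \<and> int p dvd y}"
  have D: "card (?D (int (p ^ Suc (Suc v) * m))) = card (two_squares (int (p ^ v * m)))" for v
    using card_two_squares_scale[OF p0, of "int (p ^ v * m)"] by (simp add: power2_eq_square ac_simps)
  \<comment> \<open>Base value at exponent 1: a common factor \<open>p\<close> would need
    \<open>p^2\<close> to divide \<open>p * m\<close>.\<close>
  have D1: "card (?D (int (p * m))) = 0"
    using two_squares_no_common_factor[OF p0 m'] by (simp only: of_nat_mult card.empty)
  consider "p = 2" | "[p = 1] (mod 4)" | "[p = 3] (mod 4)"
  proof -
    have "p = 2 \<or> odd p" using p primes_dvd_imp_eq two_is_prime_nat by blast
    moreover have "p mod 4 = 1 \<or> p mod 4 = 3" if "odd p" using that by presburger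
    ultimately show ?thesis using that by (auto simp: cong_def)
  qed
  then show ?thesis
  proof cases
    case 1
    have "card (two_squares (int (2 ^ v * m))) = card (two_squares (int m))"
    proof (induction v)
      case (Suc v)
      then show ?case using card_two_squares_double[of "int (2 ^ v * m)"] by (simp add: ac_simps)
    qed simp
    then show ?thesis using 1 by (simp add: two_squares_factor_def cong_def)
  next
    case 2
    have rec: "card (two_squares (int (p ^ Suc v * m))) + card (?D (int (p ^ Suc v * m))) =
        2 * card (two_squares (int (p ^ v * m)))" for v
      using card_two_squares_prime_1_mod_4[OF p 2, of "int (p ^ v * m)"] by (simp add: ac_simps)
    have "card (two_squares (int (p ^ v * m))) = (1 + v) * card (two_squares (int m))"
    proof (induction v rule: induct_nat_012)
      case 0
      then show ?case by simp
    next
      case 1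
      then show ?case using rec[of 0] D1 by simp
    next
      case (ge2 v)
      then show ?case using rec[of "Suc v"] D[of v] by (simp add: algebra_simps)
    qed
    then show ?thesis using 2 by (simp add: two_squares_factor_def algebra_simps)
  next
    case 3
    have all: "?D (int (p ^ Suc v * m)) = two_squares (int (p ^ Suc v * m))" for v
    proof -
      have "int p dvd x \<and> int p dvd y" if "x\<^sup>2 + y\<^sup>2 = int (p ^ Suc v * m)" for x y
      proof -
        have "int p dvd x\<^sup>2 + y\<^sup>2" unfolding that by simp
        moreover from this have "int p dvd y\<^sup>2 + x\<^sup>2" by (simp add: add.commute)
        ultimately show ?thesis using prime_3_mod_4_dvd_sum_squares[OF p 3] by blast
      qed
      then show ?thesis by (auto simp del: of_nat_mult of_nat_power)
    qed
    have "of_nat (card (two_squares (int (p ^ v * m)))) =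
        (1 + (-1) ^ v) / 2 * (of_nat (card (two_squares (int m))) :: rat)"
    proof (induction v rule: induct_nat_012)
      case 0
      then show ?case by simp
    next
      case 1
      then show ?case using all[of 0] D1 by simp
    next
      case (ge2 v)
      then show ?case using all[of "Suc v"] D[of v] by simp
    qed
    then show ?thesis using 3 by (simp add: two_squares_factor_def cong_def)
  qed
qed

section \<open>The product formula for two squares and its relation to \<open>Lam\<close>\<close>

text \<open>The full power of one prime is split off at once, leaving a cofactor prime to it, so
  each local factor enters exactly once.\<close>

lemma nat_prime_power_induct [consumes 1, case_names one prime_power]:
  fixes n :: nat
  assumes "n > 0" and one: "P 1"
    and step: "\<And>p v m. prime p \<Longrightarrow> v > 0 \<Longrightarrow> m > 0 \<Longrightarrow> \<not> p dvd m \<Longrightarrow> P m \<Longrightarrow> P (p ^ v * m)"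
  shows "P n"
  using \<open>n > 0\<close>
proof (induction n rule: less_induct)
  case (less n)
  show ?case
  proof (cases "n = 1")
    case False
    then obtain p where p: "prime p" "p dvd n" using prime_factor_nat by blast
    obtain m where m: "n = p ^ multiplicity p n * m" "\<not> p dvd m"
    proof (rule multiplicity_decompose')
      show "n \<noteq> 0" "\<not> is_unit p" using less.prems p(1) by auto
    qed
    have v: "multiplicity p n > 0"
      using p less.prems by (simp add: prime_multiplicity_gt_zero_iff)
    have m0: "m > 0" using m(2) by (auto intro: Nat.gr0I)
    have "1 < p ^ multiplicity p n" using v p(1) prime_gt_1_nat one_less_power by blast
    then have "m < n" using m0 by (subst m(1)) simp
    then have "P m" using less.IH m0 by blast
    then show ?thesis using step[OF p(1) v m0 m(2)] m(1) by simp
  qed (use one in simp)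
qed

lemma prod_prime_factors_prime_power_mult:
  fixes f :: "nat \<Rightarrow> nat \<Rightarrow> 'a :: comm_monoid_mult"
  assumes p: "prime p" "v > 0" and m: "m > 0" "\<not> p dvd m"
  shows "(\<Prod>q\<in>prime_factors (p ^ v * m). f q (multiplicity q (p ^ v * m))) =
    f p v * (\<Prod>q\<in>prime_factors m. f q (multiplicity q m))"
proof -
  have p0: "p ^ v \<noteq> 0" using p by auto
  have PF: "prime_factors (p ^ v * m) = insert p (prime_factors m)"
    using p m p0 by (simp add: prime_factors_product prime_factorization_prime_power)
  have "multiplicity q (p ^ v * m) = multiplicity q m" if "q \<in> prime_factors m" for q
  proof -
    have "prime q" "q \<noteq> p" using that m by (auto simp: in_prime_factors_iff)
    then show ?thesis using p m p0
      by (simp add: prime_elem_multiplicity_mult_distrib multiplicity_distinct_prime_power)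
  qed
  moreover have "multiplicity p (p ^ v * m) = v"
    using p m p0 by (simp add: prime_elem_multiplicity_mult_distrib not_dvd_imp_multiplicity_0)
  moreover have "p \<notin> prime_factors m" using m by auto
  ultimately show ?thesis unfolding PF by simp
qed

text \<open>The constant 4 is the count for \<open>n = 1\<close>, that is, the number of Gaussian
  units.\<close>

lemma card_two_squares_eq_prod:
  assumes "n > 0"
  shows "of_nat (card (two_squares (int n))) =
    4 * (\<Prod>p\<in>prime_factors n. two_squares_factor p (multiplicity p n))"
  using assms
proof (induction rule: nat_prime_power_induct)
  case one
  then show ?case by (simp add: two_squares_one)
next
  case (prime_power p v m)
  then show ?case
    by (subst prod_prime_factors_prime_power_mult)
      (simp_all add: card_two_squares_prime_power del: of_nat_mult of_nat_power)
qed

text \<open>\<open>Lam\<close> omits the prime 3, whose local factor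
  \<open>(1 + (-1) ^ b) / 2\<close>, with \<open>b\<close> its multiplicity, joins the constant
  4.\<close>

lemma card_two_squares_eq_Lam:
  assumes "n > 0"
  shows "of_nat (card (two_squares (int n))) = 2 * (1 + (-1) ^ multiplicity 3 n) * Lam n"
proof -
  let ?g = "\<lambda>p v. if p = 3 then (1 + (-1) ^ v) / 2 else (1 :: rat)"
  \<comment> \<open>Padding with 1 turns both filtered products into products over all prime
    factors, which can be merged termwise.\<close>
  have Lam: "Lam n = (\<Prod>p\<in>prime_factors n. if [p = 1] (mod 4) then 1 + of_nat (multiplicity p n) else 1) *
     (\<Prod>q\<in>prime_factors n. if 3 < q \<and> [q = 3] (mod 4) then (1 + (-1) ^ multiplicity q n) / 2 else 1)"
    unfolding Lam_def by (simp add: prod.inter_filter)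
  have "two_squares_factor p v = (if [p = 1] (mod 4) then 1 + of_nat v else 1) *
     (if 3 < p \<and> [p = 3] (mod 4) then (1 + (-1) ^ v) / 2 else 1) * ?g p v" if "prime p" for p v
    using prime_ge_2_nat[OF that] by (cases "p = 3") (auto simp: two_squares_factor_def cong_def)
  then have "(\<Prod>p\<in>prime_factors n. two_squares_factor p (multiplicity p n)) =
      Lam n * (\<Prod>p\<in>prime_factors n. ?g p (multiplicity p n))"
    unfolding Lam prod.distrib[symmetric] by (intro prod.cong) (simp_all add: in_prime_factors_iff)
  also have "(\<Prod>p\<in>prime_factors n. ?g p (multiplicity p n)) = (1 + (-1) ^ multiplicity 3 n) / 2"
  proof (cases "3 \<in> prime_factors n")
    case True
    have "(\<Prod>p\<in>prime_factors n. ?g p (multiplicity p n)) =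
      (\<Prod>p\<in>prime_factors n. if p = 3 then (1 + (-1) ^ multiplicity 3 n) / 2 else 1)"
      by (intro prod.cong) auto
    then show ?thesis using True by (simp add: prod.delta)
  next
    case False
    then have "multiplicity 3 n = 0"
      using assms by (auto simp: in_prime_factors_iff intro: not_dvd_imp_multiplicity_0)
    moreover have "(\<Prod>p\<in>prime_factors n. ?g p (multiplicity p n)) = (\<Prod>p\<in>prime_factors n. 1)"
      using False by (intro prod.cong) auto
    ultimately show ?thesis by simp
  qed
  finally have "(\<Prod>p\<in>prime_factors n. two_squares_factor p (multiplicity p n)) =
    Lam n * ((1 + (-1) ^ multiplicity 3 n) / 2)" .
  then show ?thesis unfolding card_two_squares_eq_prod[OF assms] by (simp add: algebra_simps)
qed

section \<open>The residue modulo 3 of a sum of two squares\<close>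

lemma two_squares_mod_3:
  assumes "n > 0" "\<not> 3 dvd n" "two_squares (int n) \<noteq> {}"
  shows "[int n = (-1) ^ (multiplicity 2 n + num_5_mod_12 n)] (mod 3)"
proof -
  \<comment> \<open>As a nonzero count, solvability passes to the cofactor through the product
    formula.\<close>
  have "card (two_squares (int n)) \<noteq> 0" using assms(3) by simp
  with assms(1,2) show ?thesis
  proof (induction rule: nat_prime_power_induct)
    case one
    then show ?case by (simp add: num_5_mod_12_def)
  next
    case (prime_power p v m)
    have p: "prime p" and v: "v > 0" and m: "m > 0" "\<not> p dvd m" by fact+
    have p0: "p ^ v \<noteq> 0" using p by auto
    have "\<not> 3 dvd p" "\<not> 3 dvd m"
      using prime_power.prems(1) v by (auto intro: dvd_mult2 dvd_trans[OF _ dvd_power])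
    have card: "of_nat (card (two_squares (int (p ^ v * m)))) =
        two_squares_factor p v * of_nat (card (two_squares (int m)))"
      by (rule card_two_squares_prime_power[OF p m(2)])
    then have nz: "two_squares_factor p v \<noteq> 0" "card (two_squares (int m)) \<noteq> 0"
      using prime_power.prems(2) by (auto simp del: of_nat_mult of_nat_power)
    have IH: "[int m = (-1) ^ (multiplicity 2 m + num_5_mod_12 m)] (mod 3)"
      using prime_power.IH nz(2) \<open>\<not> 3 dvd m\<close> by blast
    have t: "num_5_mod_12 (p ^ v * m) = (if [p = 5] (mod 12) then v else 0) + num_5_mod_12 m"
    proof -
      have "filter_mset P (replicate_mset v p) = (if P p then replicate_mset v p else {#})" for P
        by (induction v) auto
      then show ?thesis using p m p0
        by (simp add: num_5_mod_12_def prime_factorization_mult prime_factorization_prime_power)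
    qed
    have a: "multiplicity 2 (p ^ v * m) = (if p = 2 then v else 0) + multiplicity 2 m"
      using p m p0
      by (auto simp: prime_elem_multiplicity_mult_distrib multiplicity_distinct_prime_power)
    have "[int p ^ v = (-1) ^ ((if p = 2 then v else 0) + (if [p = 5] (mod 12) then v else 0))] (mod 3)"
    proof -
      \<comment> \<open>Odd primes other than 3 are 1, 5, 7 or 11 modulo 12; the residues 1 and 7
        are 1 modulo 3 and contribute no sign.\<close>
      consider "[p = 1] (mod 3)" "\<not> [p = 5] (mod 12)" "p \<noteq> 2" | "p = 2" | "[p = 5] (mod 12)" | "[p = 11] (mod 12)"
      proof -
        have "p = 2 \<or> odd p" using p primes_dvd_imp_eq two_is_prime_nat by blast
        moreover have "p mod 12 = 5 \<or> p mod 12 = 11 \<or> (p mod 3 = 1 \<and> p mod 12 \<noteq> 5)" if "odd p"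
        proof -
          obtain r where r: "r < 12" "p mod 12 = r" "p mod 3 = r mod 3" "3 dvd r \<longleftrightarrow> 3 dvd p" "2 dvd r \<longleftrightarrow> 2 dvd p"
            by (rule that[of "p mod 12"]) (simp_all add: mod_mod_cancel dvd_mod_iff)
          have "r \<in> {0, 1, 2, 3, 4, 5, 6, 7, 8, 9, 10, 11}"
            using r(1) by (simp add: numeral_eq_Suc less_Suc_eq)
          moreover have "odd r" "\<not> 3 dvd r" using r(4,5) that \<open>\<not> 3 dvd p\<close> by blast+
          ultimately show ?thesis unfolding r(2,3) by auto
        qed
        ultimately show ?thesis using that by (auto simp: cong_def)
      qed
      then show ?thesis
      proof cases
        case 1
        then have "[int p = int 1] (mod int 3)" by (simp only: cong_int_iff)
        then show ?thesis using 1 cong_pow[of "int p" 1 3 v] by simp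
      next
        case 2
        have "[2 ^ v = (-1) ^ v] (mod (3 :: int))" by (intro cong_pow) (simp add: cong_def)
        then show ?thesis using 2 by (simp add: cong_def)
      next
        case 3
        then have "[int p = int 5] (mod int 12)" by (simp only: cong_int_iff)
        then have "[int p = int 5] (mod 3)" by (rule cong_dvd_modulus) simp
        then have "[int p = - 1] (mod 3)" by (simp add: cong_def)
        then have "[int p ^ v = (-1) ^ v] (mod 3)" by (rule cong_pow)
        moreover have "p \<noteq> 2" using 3 by (auto simp: cong_def)
        ultimately show ?thesis using 3 by simp
      next
        case 4
        then have "[p = 11] (mod 4)" by (rule cong_dvd_modulus_nat) simp
        then have "[p = 3] (mod 4)" by (simp add: cong_def)
        then have "two_squares_factor p v = (1 + (-1) ^ v) / 2"
          by (simp add: two_squares_factor_def cong_def)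
        \<comment> \<open>An odd exponent would make the local factor, hence the count,
          vanish.\<close>
        then have "even v" using nz(1) by (cases "even v") simp_all
        from 4 have "[int p = int 11] (mod int 12)" by (simp only: cong_int_iff)
        then have "[int p = int 11] (mod 3)" by (rule cong_dvd_modulus) simp
        then have "[int p = - 1] (mod 3)" by (simp add: cong_def)
        then have "[int p ^ v = (-1) ^ v] (mod 3)" by (rule cong_pow)
        moreover have "p \<noteq> 2" "\<not> [p = 5] (mod 12)" using 4 by (auto simp: cong_def)
        ultimately show ?thesis using \<open>even v\<close> by simp
      qed
    qed
    from cong_mult[OF this IH] show ?case
      unfolding a t by (simp add: power_add ac_simps)
  qed
qed

section \<open>The two forms as two squares with a congruence condition modulo 3\<close>

lemma form_reps_1_0_9: "form_reps 1 0 9 n = card {(x, y) \<in> two_squares n. 3 dvd y}"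
proof -
  have "{(x, y) \<in> two_squares n. 3 dvd y} = (\<lambda>(x, y). (x, 3 * y)) ` {(x, y). 1 * x\<^sup>2 + 0 * x * y + 9 * y\<^sup>2 = n}"
    by (force elim!: dvdE)
  moreover have "inj_on (\<lambda>(x :: int, y). (x, 3 * y :: int)) S" for S by (auto simp: inj_on_def)
  ultimately show ?thesis unfolding form_reps_def by (simp only: card_image)
qed

text \<open>With \<open>u = x - y\<close> and \<open>v = x + 2 * y\<close> the form is
  \<open>u^2 + v^2\<close> and \<open>v - u = 3 * y\<close>; hence \<open>y = (v - u) / 3\<close>
  and \<open>x = u + y\<close> recover the pair.\<close>

lemma form_reps_2_2_5: "form_reps 2 2 5 n = card {(u, v) \<in> two_squares n. 3 dvd v - u}"
proof -
  have id: "2 * x\<^sup>2 + 2 * x * y + 5 * y\<^sup>2 = (x - y)\<^sup>2 + (x + 2 * y)\<^sup>2" for x y :: int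
    by (simp add: power2_eq_square algebra_simps)
  have "{(u, v) \<in> two_squares n. 3 dvd v - u} =
      (\<lambda>(x, y). (x - y, x + 2 * y)) ` {(x, y). 2 * x\<^sup>2 + 2 * x * y + 5 * y\<^sup>2 = n}"
  proof (intro equalityI subrelI)
    fix u v assume uv: "(u, v) \<in> {(u, v) \<in> two_squares n. 3 dvd v - u}"
    then obtain y where "v - u = 3 * y" by auto
    then have "u = (u + y) - y" "v = (u + y) + 2 * y" by auto
    with uv show "(u, v) \<in> (\<lambda>(x, y). (x - y, x + 2 * y)) ` {(x, y). 2 * x\<^sup>2 + 2 * x * y + 5 * y\<^sup>2 = n}"
      unfolding id by (intro image_eqI[of _ _ "(u + y, y)"]) auto
  next
    fix u v
    assume "(u, v) \<in> (\<lambda>(x, y). (x - y, x + 2 * y)) ` {(x, y). 2 * x\<^sup>2 + 2 * x * y + 5 * y\<^sup>2 = n}"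
    then show "(u, v) \<in> {(u, v) \<in> two_squares n. 3 dvd v - u}"
      unfolding id by auto
  qed
  moreover have "inj_on (\<lambda>(x, y). (x - y, x + 2 * y :: int)) S" for S by (auto simp: inj_on_def)
  ultimately show ?thesis unfolding form_reps_def by (simp only: card_image)
qed

lemma square_mod_3: "(x :: int)\<^sup>2 mod 3 = (if 3 dvd x then 0 else 1)"
proof (cases "3 dvd x")
  case True
  then show ?thesis by (simp add: power2_eq_square)
next
  case False
  then have "3 dvd x - 1 \<or> 3 dvd x + 1" by presburger
  then have "3 dvd (x - 1) * (x + 1)" by (auto intro: dvd_mult dvd_mult2)
  then have "3 dvd x\<^sup>2 - 1" by (simp add: power2_eq_square algebra_simps)
  then have "x\<^sup>2 mod 3 = 1 mod 3" by (simp only: mod_eq_dvd_iff)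
  with False show ?thesis by simp
qed

text \<open>The two residues are 0 or 1, so their sum is already reduced modulo 3.\<close>

lemma sum_squares_mod_3:
  "(x\<^sup>2 + y\<^sup>2) mod 3 = (if 3 dvd x then 0 else 1) + (if 3 dvd y then 0 else (1 :: int))"
proof -
  have "(x\<^sup>2 + y\<^sup>2) mod 3 = (x\<^sup>2 mod 3 + y\<^sup>2 mod 3) mod 3" by (simp add: mod_add_eq)
  then show ?thesis unfolding square_mod_3 by simp
qed

lemma form_reps_3_dvd:
  assumes "3 dvd n"
  shows "form_reps 1 0 9 n = card (two_squares n)" "form_reps 2 2 5 n = card (two_squares n)"
proof -
  have "3 dvd x \<and> 3 dvd y" if "x\<^sup>2 + y\<^sup>2 = n" for x y :: int
    using assms sum_squares_mod_3[of x y] unfolding that by (auto split: if_splits)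
  then have "{(x, y) \<in> two_squares n. 3 dvd y} = two_squares n"
    "{(x, y) \<in> two_squares n. 3 dvd y - x} = two_squares n"
    by (auto intro: dvd_diff)
  then show "form_reps 1 0 9 n = card (two_squares n)" "form_reps 2 2 5 n = card (two_squares n)"
    by (simp_all add: form_reps_1_0_9 form_reps_2_2_5)
qed

lemma form_reps_1_mod_3:
  assumes "[n = 1] (mod 3)"
  shows "2 * form_reps 1 0 9 n = card (two_squares n)" "form_reps 2 2 5 n = 0"
proof -
  let ?A = "{(x, y) \<in> two_squares n. 3 dvd y}" and ?B = "{(x, y) \<in> two_squares n. 3 dvd x}"
  have one: "3 dvd x \<or> 3 dvd y" "\<not> (3 dvd x \<and> 3 dvd y)" if "x\<^sup>2 + y\<^sup>2 = n" for x y :: int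
    using assms sum_squares_mod_3[of x y] unfolding that cong_def by (auto split: if_splits)
  have Un: "?A \<union> ?B = two_squares n" and Int: "?A \<inter> ?B = {}"
    using one unfolding two_squares_def by blast+
  have fin: "finite ?A" "finite ?B" by (auto intro: finite_subset[OF _ finite_two_squares[of n]])
  have "card (two_squares n) = card ?A + card ?B"
    using card_Un_disjoint[OF fin Int] unfolding Un .
  \<comment> \<open>Swapping coordinates shows that the two disjoint classes are equally
    large.\<close>
  moreover have "bij_betw prod.swap ?A ?B"
    by (rule bij_betw_byWitness[of _ prod.swap]) (auto simp: add.commute)
  from bij_betw_same_card[OF this] have "card ?A = card ?B" .
  ultimately show "2 * form_reps 1 0 9 n = card (two_squares n)"
    unfolding form_reps_1_0_9 by linarith
  have "{(x, y) \<in> two_squares n. 3 dvd y - x} = {}"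
  proof -
    have "\<not> 3 dvd y - x" if "x\<^sup>2 + y\<^sup>2 = n" for x y :: int
      using one[OF that] by (auto simp: dvd_diff_left_iff dvd_diff_right_iff)
    then show ?thesis by auto
  qed
  then show "form_reps 2 2 5 n = 0" by (simp only: form_reps_2_2_5 card.empty)
qed

lemma form_reps_2_mod_3:
  assumes "[n = -1] (mod 3)"
  shows "form_reps 1 0 9 n = 0" "2 * form_reps 2 2 5 n = card (two_squares n)"
proof -
  let ?A = "{(x, y) \<in> two_squares n. 3 dvd y - x}" and ?B = "{(x, y) \<in> two_squares n. 3 dvd y + x}"
  have none: "\<not> 3 dvd x \<and> \<not> 3 dvd y" if "x\<^sup>2 + y\<^sup>2 = n" for x y :: int
    using assms sum_squares_mod_3[of x y] unfolding that cong_def by (auto split: if_splits)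
  \<comment> \<open>Both coordinates are 1 or -1 modulo 3, hence either equal or opposite, but not
    both.\<close>
  have one: "3 dvd y - x \<longleftrightarrow> \<not> 3 dvd y + x" if "x\<^sup>2 + y\<^sup>2 = n" for x y :: int
    using none[OF that] by presburger
  have Un: "?A \<union> ?B = two_squares n" and Int: "?A \<inter> ?B = {}"
    using one unfolding two_squares_def by blast+
  have fin: "finite ?A" "finite ?B" by (auto intro: finite_subset[OF _ finite_two_squares[of n]])
  have "card (two_squares n) = card ?A + card ?B"
    using card_Un_disjoint[OF fin Int] unfolding Un .
  \<comment> \<open>Negating \<open>x\<close> exchanges the two classes.\<close>
  moreover have "bij_betw (\<lambda>(x, y). (- x, y)) ?A ?B"
    by (rule bij_betw_byWitness[of _ "\<lambda>(x, y). (- x, y)"]) auto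
  from bij_betw_same_card[OF this] have "card ?A = card ?B" .
  ultimately show "2 * form_reps 2 2 5 n = card (two_squares n)"
    unfolding form_reps_2_2_5 by linarith
  have "{(x, y) \<in> two_squares n. 3 dvd y} = {}" using none unfolding two_squares_def by blast
  then show "form_reps 1 0 9 n = 0" by (simp only: form_reps_1_0_9 card.empty)
qed

theorem theorem4p1:
  fixes n a b t :: nat
  assumes "n > 0"
    and "a = multiplicity 2 n"
    and "b = multiplicity 3 n"
    and "t = num_5_mod_12 n"
  shows "of_nat (form_reps 1 0 9 (int n)) =
           (if b = 0 then (1 + (-1) ^ (a + t)) * Lam n
            else if odd b then 0
            else 4 * Lam n) \<and>
         of_nat (form_reps 2 2 5 (int n)) =
           (if b = 0 then (1 - (-1) ^ (a + t)) * Lam n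
            else if odd b then 0
            else 4 * Lam n)"
proof -
  have card: "of_nat (card (two_squares (int n))) = 2 * (1 + (-1) ^ b) * Lam n"
    using card_two_squares_eq_Lam assms by simp
  show ?thesis
  proof (cases "b = 0")
    case False
    \<comment> \<open>Both forms count all of \<open>two_squares\<close>, and
      \<open>2 * (1 + (-1) ^ b)\<close> is 0 or 4 by the parity of \<open>b\<close>.\<close>
    then have "3 dvd n" using assms(3) not_dvd_imp_multiplicity_0[of 3 n] by auto
    then have "int 3 dvd int n" by (simp only: int_dvd_int_iff)
    then show ?thesis using form_reps_3_dvd[of "int n"] card False by simp
  next
    case b: True
    then have not3: "\<not> 3 dvd n" using assms by (simp add: multiplicity_eq_zero_iff)
    show ?thesis
    proof (cases "two_squares (int n) = {}")
      case True
      then have "Lam n = 0" using card b by simp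
      then show ?thesis using True b by (simp add: form_reps_1_0_9 form_reps_2_2_5)
    next
      case False
      have cong: "[int n = (-1) ^ (a + t)] (mod 3)"
        unfolding assms(2,4) by (rule two_squares_mod_3[OF assms(1) not3 False])
      show ?thesis
      proof (cases "even (a + t)")
        case True
        then have "[int n = 1] (mod 3)" using cong by simp
        note reps = form_reps_1_mod_3[OF this]
        \<comment> \<open>The total is \<open>4 * Lam n\<close>, so the half is
          \<open>2 * Lam n\<close>, matching \<open>1 + (-1) ^ (a + t) = 2\<close>.\<close>
        have "2 * of_nat (form_reps 1 0 9 (int n)) = (of_nat (card (two_squares (int n))) :: rat)"
          by (simp flip: reps(1))
        with reps(2) card b True show ?thesis by simp
      next
        case False
        then have "[int n = -1] (mod 3)" using cong by simp
        note reps = form_reps_2_mod_3[OF this]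
        have "2 * of_nat (form_reps 2 2 5 (int n)) = (of_nat (card (two_squares (int n))) :: rat)"
          by (simp flip: reps(2))
        with reps(1) card b False show ?thesis by simp
      qed
    qed
  qed
qed

end
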